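(* Let $\varnothing\ne T\subset\mathbb{R}$, let $(M,\|\cdot\|)$ be a normed linear space over $\mathbb{R}$ or $\mathbb{C}$, and let $\{f_j\}_{j=1}^\infty\subset M^T$ be a pointwise relatively compact sequence of functions such that $$\limsup_{j,k\to\infty}V_\varepsilon(f_j-f_k,T)<\infty\quad\text{for all }\varepsilon>0.$$ Then $\{f_j\}$ contains a subsequence which converges pointwise on $T$ (in the norm of $M$).
   Context: $M^T$ is the set of all functions $f:T\to M$. For $f,g\in M^T$ put $\|f-g\|_{\infty,T}=\sup_{t\in T}\|f(t)-g(t)\|$. The (Jordan) variation of $g\in M^T$ is $V(g,T)=\sup\sum_{i=1}^m\|g(t_i)-g(t_{i-1})\|\in[0,\infty]$, the supremum being over all $m\in\mathbb{N}$ and all $t_0\le t_1\le\dots\le t_m$ in $T$; $\mathrm{BV}(T;M)=\{g\in M^T:V(g,T)<\infty\}$. For $\varepsilon>0$, the $\varepsilon$-variation of $f\in M^T$ is $$V_\varepsilon(f,T)=\inf\{V(g,T):g\in\mathrm{BV}(T;M),\ \|f-g\|_{\infty,T}\le\varepsilon\}\in[0,\infty],\qquad \inf\varnothing=\infty.$$ The sequence $\{f_j\}$ is pointwise relatively compact on $T$ if for every $t\in T$ the closure in $M$ of $\{f_j(t):j\in\mathbb{N}\}$ is compact. For $\alpha:\mathbb{N}\times\mathbb{N}\to[0,\infty]$, $\limsup_{j,k\to\infty}\alpha(j,k)=\lim_{n\to\infty}\sup\{\alpha(j,k):j\ge n\text{ and }k\ge n\}$. *)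

theory Defs
  imports "HOL-Analysis.Analysis"
begin

text \<open>
  A function from \<open>T\<close> to \<open>M\<close> is represented by a total function on the reals; each notion below
  depends only on its values on \<open>T\<close>. Norms and variations are taken in \<^typ>\<open>ennreal\<close>, where an
  infimum over the empty set is \<open>\<infinity>\<close>.
\<close>

definition sup_dist :: "(real \<Rightarrow> 'a::real_normed_vector) \<Rightarrow> (real \<Rightarrow> 'a) \<Rightarrow> real set \<Rightarrow> ennreal" where
  "sup_dist f g T = (SUP t\<in>T. ennreal (norm (f t - g t)))"

definition jordan_variation :: "(real \<Rightarrow> 'a::real_normed_vector) \<Rightarrow> real set \<Rightarrow> ennreal" where
  "jordan_variation g T =
     (SUP (m, t) \<in> {(m::nat, t::nat \<Rightarrow> real).
                      1 \<le> m \<and> (\<forall>i\<le>m. t i \<in> T) \<and> (\<forall>i\<in>{1..m}. t (i - 1) \<le> t i)}.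
        \<Sum>i=1..m. ennreal (norm (g (t i) - g (t (i - 1)))))"

definition BV :: "real set \<Rightarrow> (real \<Rightarrow> 'a::real_normed_vector) set" where
  "BV T = {g. jordan_variation g T < \<infinity>}"

definition eps_variation :: "real \<Rightarrow> (real \<Rightarrow> 'a::real_normed_vector) \<Rightarrow> real set \<Rightarrow> ennreal" where
  "eps_variation \<epsilon> f T =
     (INF g\<in>{g \<in> BV T. sup_dist f g T \<le> ennreal \<epsilon>}. jordan_variation g T)"

definition pointwise_relatively_compact ::
    "(nat \<Rightarrow> real \<Rightarrow> 'a::real_normed_vector) \<Rightarrow> real set \<Rightarrow> bool" where
  "pointwise_relatively_compact f T \<longleftrightarrow> (\<forall>t\<in>T. compact (closure (range (\<lambda>j. f j t))))"

text \<open>The limit below always exists: the suprema decrease in \<open>n\<close>.\<close>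

definition double_limsup :: "(nat \<Rightarrow> nat \<Rightarrow> ennreal) \<Rightarrow> ennreal" where
  "double_limsup \<alpha> = lim (\<lambda>n. SUP (j, k) \<in> {(j, k). n \<le> j \<and> n \<le> k}. \<alpha> j k)"

end

theory Submission
  imports Defs
begin

text \<open>
  Fix \<open>\<epsilon> > 0\<close>. The hypothesis yields an index \<open>N\<close> such that for \<open>j \<ge> N\<close> the functions \<open>f\<^sub>j - f\<^sub>N\<close>
  are \<open>\<epsilon>\<close>-close on \<open>T\<close> to functions \<open>g\<^sub>j\<close> whose variations have a common finite bound. The \<open>g\<^sub>j\<close>
  themselves need not have any compactness in \<open>M\<close>, but their variation functions
  \<open>F\<^sub>j x = V(g\<^sub>j, T \<inter> (-\<infinity>, x])\<close> are real, nondecreasing and uniformly bounded, so the idea of Helly's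
  theorem applies to them: along a subsequence, and outside a countable set \<open>D\<close>, every point has a
  neighbourhood on which \<open>F\<^sub>j\<close> increases by at most \<open>\<epsilon>\<close> for all large \<open>j\<close>
  (\<open>monotone_family_small_increments\<close>). An increment of \<open>F\<^sub>j\<close> dominates the corresponding increment
  of \<open>g\<^sub>j\<close> (\<open>norm_diff_le_variation_increment\<close>), hence \<open>f\<^sub>j - f\<^sub>N\<close> oscillates by at most \<open>3\<epsilon>\<close> on that
  neighbourhood. A diagonal argument provides one subsequence and one countable \<open>D\<close> for all
  \<open>\<epsilon> = 1/(p+1)\<close> at once.

  Passing to a further subsequence, pointwise relative compactness makes \<open>f\<^sub>j s\<close> converge for every \<open>s\<close>
  in a countable dense subset of \<open>T\<close> that contains \<open>D \<inter> T\<close>. At any other \<open>t \<in> T\<close>, comparing \<open>t\<close>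
  with a nearby \<open>s\<close> of that subset shows that \<open>f\<^sub>j t\<close> is a Cauchy sequence: the fixed function \<open>f\<^sub>N\<close>
  cancels in \<open>f\<^sub>j - f\<^sub>k\<close>. Relative compactness replaces completeness of \<open>M\<close> in the last step.
\<close>

section \<open>Subsequences converging at countably many places\<close>

text \<open>
  The countable product of the compact sets is compact and metrizable, hence sequentially compact;
  this packages Cantor's diagonal argument.
\<close>

lemma countable_family_convergent_subsequence:
  fixes u :: "nat \<Rightarrow> 'i::countable \<Rightarrow> 'b::metric_space"
  assumes compact: "\<And>i. compact (K i)" and mem: "\<And>n i. u n i \<in> K i"
  obtains r :: "nat \<Rightarrow> nat" where "strict_mono r" "\<And>i. convergent (\<lambda>n. u (r n) i)"
proof -
  have "compactin (product_topology (\<lambda>_::'i. euclidean::'b topology) UNIV) (PiE UNIV K)"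
    using compact by (simp add: compactin_PiE)
  then have "compact (PiE UNIV K)"
    by (simp add: euclidean_product_topology)
  then have "seq_compact (PiE UNIV K)"
    by (rule compact_imp_seq_compact)
  moreover have "\<forall>n. u n \<in> PiE UNIV K"
    using mem by auto
  ultimately obtain l r where r: "strict_mono r" and l: "(u \<circ> r) \<longlonglongrightarrow> l"
    by (metis seq_compactE)
  have "(\<lambda>n. u (r n) i) \<longlonglongrightarrow> l i" for i
  proof -
    have "isCont (\<lambda>v::'i \<Rightarrow> 'b. v i) l"
      using continuous_on_product_coordinates[of i]
      by (metis UNIV_I continuous_on_eq_continuous_at open_UNIV)
    from isCont_tendsto_compose[OF this l] show ?thesis
      by (simp add: o_def)
  qed
  then show thesis
    using that[OF r] by (auto simp: convergent_def)
qed

text \<open>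
  Outside the countable discontinuity set of the limit, the increments over a small rational
  interval are eventually small because they converge at both endpoints. Only convergence at
  rational points is used, so the limit function is built from the values there.
\<close>

lemma monotone_family_small_increments:
  fixes F :: "nat \<Rightarrow> nat \<Rightarrow> real \<Rightarrow> real"
  assumes mono: "\<And>p j. mono (F p j)"
    and bounds: "\<And>p j x. 0 \<le> F p j x" "\<And>p j x. F p j x \<le> C p"
  obtains r :: "nat \<Rightarrow> nat" and D :: "real set"
  where "strict_mono r" "countable D"
    "\<And>p x e. x \<notin> D \<Longrightarrow> 0 < e \<Longrightarrow>
       \<exists>a b. a < x \<and> x < b \<and> (\<forall>\<^sub>F n in sequentially. F p (r n) b - F p (r n) a < e)"
proof -
  obtain r where r: "strict_mono r"
    and conv: "\<And>i. convergent (\<lambda>n. case i of (p, q::rat) \<Rightarrow> F p (r n) (of_rat q))"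
    by (rule countable_family_convergent_subsequence
        [where u = "\<lambda>n (p, q::rat). F p n (of_rat q)" and K = "\<lambda>(p, q::rat). {0..C p}"])
      (use bounds in \<open>auto simp: split_beta\<close>)
  define L where "L p q = lim (\<lambda>n. F p (r n) (of_rat q))" for p and q :: rat
  have L: "(\<lambda>n. F p (r n) (of_rat q)) \<longlonglongrightarrow> L p q" for p q
    using conv[of "(p, q)"] by (simp add: L_def convergent_LIMSEQ_iff)
  have L_mono: "L p q \<le> L p q'" if "q \<le> q'" for p q q'
    using L L by (rule LIMSEQ_le) (use that mono in \<open>auto simp: mono_def of_rat_less_eq\<close>)
  have L_le: "L p q \<le> C p" for p q
    by (rule LIMSEQ_le_const2[OF L]) (use bounds in auto)
  define G where "G p x = (SUP q\<in>{q. of_rat q \<le> x}. L p q)" for p and x :: real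
  have bdd: "bdd_above (L p ` A)" for p A
    using L_le by (auto intro!: bdd_aboveI[of _ "C p"])
  have nonempty: "{q::rat. of_rat q \<le> x} \<noteq> {}" for x :: real
    using of_rat_dense[of "x - 1" x] by (auto intro: less_imp_le)
  have G_mono: "mono (G p)" for p
    unfolding G_def by (intro monoI cSUP_subset_mono nonempty bdd) auto
  have G_rat: "G p (of_rat q) = L p q" for p q
    unfolding G_def
  proof (rule antisym)
    show "(SUP q'\<in>{q'. real_of_rat q' \<le> of_rat q}. L p q') \<le> L p q"
      by (intro cSUP_least nonempty) (auto simp: of_rat_less_eq intro: L_mono)
    show "L p q \<le> (SUP q'\<in>{q'. real_of_rat q' \<le> of_rat q}. L p q')"
      by (intro cSUP_upper bdd) auto
  qed
  define D where "D = (\<Union>p. {x. \<not> isCont (G p) x})"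
  have "countable D"
    unfolding D_def using mono_ctble_discont[OF G_mono] by auto
  moreover have "\<exists>a b. a < x \<and> x < b \<and> (\<forall>\<^sub>F n in sequentially. F p (r n) b - F p (r n) a < e)"
    if "x \<notin> D" "0 < e" for p x e
  proof -
    have "isCont (G p) x"
      using that by (auto simp: D_def)
    then obtain d where d: "d > 0" "\<And>y. \<bar>y - x\<bar> < d \<Longrightarrow> \<bar>G p y - G p x\<bar> < e/2"
      using \<open>0 < e\<close> unfolding continuous_at_eps_delta dist_real_def
      by (meson half_gt_zero)
    obtain qa where qa: "x - d < of_rat qa" "of_rat qa < x"
      using of_rat_dense[of "x - d" x] d by auto
    obtain qb where qb: "x < of_rat qb" "of_rat qb < x + d"
      using of_rat_dense[of x "x + d"] d by auto
    have "\<bar>L p qa - G p x\<bar> < e/2" "\<bar>L p qb - G p x\<bar> < e/2"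
      unfolding G_rat[symmetric] using qa qb by - (rule d(2), linarith)+
    then have "L p qb - L p qa < e"
      by linarith
    moreover have "(\<lambda>n. F p (r n) (of_rat qb) - F p (r n) (of_rat qa)) \<longlonglongrightarrow> L p qb - L p qa"
      by (intro tendsto_diff L)
    ultimately have "\<forall>\<^sub>F n in sequentially. F p (r n) (of_rat qb) - F p (r n) (of_rat qa) < e"
      by (simp add: order_tendstoD(2))
    then show ?thesis
      using qa qb by blast
  qed
  ultimately show thesis
    by (rule that[OF r])
qed

section \<open>The variation function\<close>

lemma jordan_variation_mono:
  assumes "S \<subseteq> T"
  shows "jordan_variation g S \<le> jordan_variation g T"
  unfolding jordan_variation_def using assms by (intro SUP_subset_mono) auto

text \<open>Any partition of \<open>T \<inter> {..s}\<close> extends to one of \<open>T \<inter> {..t}\<close> by the nodes \<open>s\<close> and \<open>t\<close>.\<close>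

lemma jordan_variation_add_norm_le:
  assumes "s \<in> T" "t \<in> T" "s \<le> t"
  shows "jordan_variation g (T \<inter> {..s}) + ennreal (norm (g t - g s)) \<le> jordan_variation g (T \<inter> {..t})"
proof -
  let ?P = "\<lambda>S. {(m::nat, u::nat \<Rightarrow> real).
     1 \<le> m \<and> (\<forall>i\<le>m. u i \<in> S) \<and> (\<forall>i\<in>{1..m}. u (i - 1) \<le> u i)}"
  let ?v = "\<lambda>(m, u). \<Sum>i=1..m. ennreal (norm (g (u i) - g (u (i - 1))))"
  have nonempty: "?P (T \<inter> {..s}) \<noteq> {}"
    using assms by (auto intro!: exI[of _ 1] exI[of _ "\<lambda>_. s"])
  have "?v z + ennreal (norm (g t - g s)) \<le> jordan_variation g (T \<inter> {..t})"
    if z: "z \<in> ?P (T \<inter> {..s})" for z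
  proof -
    obtain m u where zmu: "z = (m, u)"
      by (cases z)
    have u: "1 \<le> m" "\<And>i. i \<le> m \<Longrightarrow> u i \<in> T \<inter> {..s}" "\<And>i. i \<in> {1..m} \<Longrightarrow> u (i - 1) \<le> u i"
      using z zmu by auto
    define w where "w i = (if i \<le> m then u i else if i = Suc m then s else t)" for i
    have w: "(Suc (Suc m), w) \<in> ?P (T \<inter> {..t})"
    proof -
      have "w i \<in> T \<inter> {..t}" for i
        using u(2)[of i] assms by (auto simp: w_def)
      moreover have "w (i - 1) \<le> w i" if "i \<in> {1..Suc (Suc m)}" for i
      proof -
        have "i \<in> {1..m} \<or> i = Suc m \<or> i = Suc (Suc m)"
          using that by auto
        then show ?thesis
          using u(2)[of m] u(3)[of i] assms by (auto simp: w_def)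
      qed
      ultimately show ?thesis by simp
    qed
    have w_end: "w m = u m" "w (Suc m) = s" "w (Suc (Suc m)) = t"
      by (auto simp: w_def)
    have w_start: "(\<Sum>i=1..m. ennreal (norm (g (w i) - g (w (i - 1)))))
        = (\<Sum>i=1..m. ennreal (norm (g (u i) - g (u (i - 1)))))"
      by (intro sum.cong) (auto simp: w_def)
    have "?v z + ennreal (norm (g t - g s))
        \<le> ?v z + ennreal (norm (g s - g (u m))) + ennreal (norm (g t - g s))"
      by (intro add_right_mono) simp
    also have "\<dots> = ?v (Suc (Suc m), w)"
      using w_start by (simp add: zmu w_end del: sum_ennreal)
    also have "\<dots> \<le> jordan_variation g (T \<inter> {..t})"
      unfolding jordan_variation_def by (rule SUP_upper[OF w])
    finally show ?thesis .
  qed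
  then have "(SUP z\<in>?P (T \<inter> {..s}). ?v z + ennreal (norm (g t - g s)))
      \<le> jordan_variation g (T \<inter> {..t})"
    by (rule SUP_least)
  then show ?thesis
    using nonempty by (simp add: ennreal_SUP_add_left jordan_variation_def)
qed

definition variation_function :: "(real \<Rightarrow> 'a::real_normed_vector) \<Rightarrow> real set \<Rightarrow> real \<Rightarrow> real" where
  "variation_function g T x = enn2real (jordan_variation g (T \<inter> {..x}))"

context
  fixes g :: "real \<Rightarrow> 'a::real_normed_vector" and T :: "real set"
  assumes finite_variation: "jordan_variation g T < \<infinity>"
begin

lemma jordan_variation_initial_finite: "jordan_variation g (T \<inter> {..x}) < \<infinity>"
  using jordan_variation_mono[of "T \<inter> {..x}" T g] finite_variation by auto

lemma mono_variation_function: "mono (variation_function g T)"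
  unfolding variation_function_def
  using jordan_variation_initial_finite
  by (intro monoI enn2real_mono jordan_variation_mono) auto

lemma variation_function_le:
  assumes "jordan_variation g T \<le> ennreal C" "0 \<le> C"
  shows "variation_function g T x \<le> C"
proof -
  have "jordan_variation g (T \<inter> {..x}) \<le> ennreal C"
    using jordan_variation_mono[of "T \<inter> {..x}" T g] assms by auto
  then show ?thesis
    unfolding variation_function_def using assms(2) by (rule enn2real_leI[rotated])
qed

text \<open>
  The ends \<open>a\<close>, \<open>b\<close> may lie outside \<open>T\<close>: in the application they are rational numbers near a given
  point of \<open>T\<close>.
\<close>

lemma norm_diff_le_variation_increment:
  assumes "s \<in> T" "t \<in> T" "s \<in> {a..b}" "t \<in> {a..b}"
  shows "norm (g t - g s) \<le> variation_function g T b - variation_function g T a"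
proof -
  have increment: "norm (g t - g s) \<le> variation_function g T t - variation_function g T s"
    if "s \<in> T" "t \<in> T" "s \<le> t" for s t
  proof -
    have "ennreal (variation_function g T s + norm (g t - g s)) \<le> ennreal (variation_function g T t)"
      using jordan_variation_add_norm_le[OF that, of g] jordan_variation_initial_finite
      by (simp add: variation_function_def)
    then show ?thesis
      by (subst (asm) ennreal_le_iff) (auto simp: variation_function_def)
  qed
  have "norm (g t - g s) \<le> variation_function g T (max s t) - variation_function g T (min s t)"
    using increment[of s t] increment[of t s] assms
    by (cases "s \<le> t") (auto simp: norm_minus_commute max_def min_def)
  also have "\<dots> \<le> variation_function g T b - variation_function g T a"
    using assms by (intro diff_mono monoD[OF mono_variation_function]) auto
  finally show ?thesis .
qed

end

section \<open>Approximants of bounded variation\<close>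

lemma double_limsup_finite_bound:
  assumes "double_limsup \<alpha> < \<infinity>"
  obtains N C where "0 \<le> C" "\<And>j k. N \<le> j \<Longrightarrow> N \<le> k \<Longrightarrow> \<alpha> j k \<le> ennreal C"
proof -
  let ?s = "\<lambda>n. SUP (j, k) \<in> {(j, k). n \<le> j \<and> n \<le> k}. \<alpha> j k"
  have "decseq ?s"
    unfolding decseq_def by (intro allI impI SUP_subset_mono) auto
  then have "lim ?s = (INF n. ?s n)"
    by (intro limI LIMSEQ_INF)
  then have "(INF n. ?s n) < \<infinity>"
    using assms by (simp add: double_limsup_def)
  then obtain N where N: "?s N < \<infinity>"
    by (auto simp: INF_less_iff)
  show thesis
  proof (rule that[of "enn2real (?s N)" N])
    fix j k assume "N \<le> j" "N \<le> k"
    then have "\<alpha> j k \<le> ?s N"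
      by (intro SUP_upper2[of "(j, k)"]) auto
    then show "\<alpha> j k \<le> ennreal (enn2real (?s N))"
      using N by simp
  qed simp
qed

lemma eps_variation_approximant:
  assumes "eps_variation \<epsilon> h T \<le> ennreal C" "0 < \<epsilon>" "0 \<le> C"
  obtains g where "jordan_variation g T \<le> ennreal (C + 1)" "\<And>t. t \<in> T \<Longrightarrow> norm (h t - g t) \<le> \<epsilon>"
proof -
  have "eps_variation \<epsilon> h T < ennreal (C + 1)"
    using assms by (auto simp: ennreal_lessI intro: le_less_trans)
  then obtain g where g: "jordan_variation g T < ennreal (C + 1)" "sup_dist h g T \<le> ennreal \<epsilon>"
    by (auto simp: eps_variation_def INF_less_iff)
  have "norm (h t - g t) \<le> \<epsilon>" if "t \<in> T" for t
  proof -
    have "ennreal (norm (h t - g t)) \<le> ennreal \<epsilon>"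
      using g(2) that by (auto simp: sup_dist_def SUP_le_iff)
    then show ?thesis
      using assms(2) by (simp add: ennreal_le_iff)
  qed
  then show thesis
    using that[of g] g(1) by (auto intro: less_imp_le)
qed

text \<open>For the finitely many \<open>j < N\<close> the approximant is \<open>0\<close>, which keeps the bound uniform in \<open>j\<close>.\<close>

lemma bounded_variation_approximants:
  fixes f :: "nat \<Rightarrow> real \<Rightarrow> 'a::real_normed_vector"
  assumes "double_limsup (\<lambda>j k. eps_variation \<epsilon> (\<lambda>t. f j t - f k t) T) < \<infinity>" "0 < \<epsilon>"
  obtains N :: nat and C :: real and g :: "nat \<Rightarrow> real \<Rightarrow> 'a"
  where "0 \<le> C" "\<And>j. jordan_variation (g j) T \<le> ennreal C"
    "\<And>j t. N \<le> j \<Longrightarrow> t \<in> T \<Longrightarrow> norm (f j t - f N t - g j t) \<le> \<epsilon>"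
proof -
  obtain N C where C: "0 \<le> C"
    and le: "\<And>j k. N \<le> j \<Longrightarrow> N \<le> k \<Longrightarrow> eps_variation \<epsilon> (\<lambda>t. f j t - f k t) T \<le> ennreal C"
    using double_limsup_finite_bound[OF assms(1)] by metis
  have zero: "jordan_variation (\<lambda>_. 0::'a) T \<le> ennreal (C + 1)"
    by (auto simp: jordan_variation_def SUP_le_iff)
  have "\<exists>g. jordan_variation g T \<le> ennreal (C + 1) \<and>
      (N \<le> j \<longrightarrow> (\<forall>t\<in>T. norm (f j t - f N t - g t) \<le> \<epsilon>))" for j
  proof (cases "N \<le> j")
    case True
    show ?thesis
      using eps_variation_approximant[OF le[OF True order_refl] assms(2) C] by metis
  next
    case False
    then show ?thesis
      using zero by blast
  qed
  then obtain g where "\<And>j. jordan_variation (g j) T \<le> ennreal (C + 1)"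
      "\<And>j t. N \<le> j \<Longrightarrow> t \<in> T \<Longrightarrow> norm (f j t - f N t - g j t) \<le> \<epsilon>"
    by metis
  then show thesis
    using that[of "C + 1" g N] C by auto
qed

section \<open>The selection principle\<close>

text \<open>
  In the application \<open>x\<close> and \<open>y\<close> are values of \<open>f\<^sub>j\<close>, \<open>f\<^sub>k\<close> at \<open>t\<close> and at a nearby \<open>s\<close>, while \<open>a\<close> and \<open>b\<close>
  are the values of \<open>f\<^sub>N\<close> there. Since \<open>a\<close> and \<open>b\<close> do not depend on \<open>j\<close>, \<open>k\<close>, they cancel;
  this is why control of the differences \<open>f\<^sub>j - f\<^sub>N\<close> suffices.
\<close>

lemma norm_diff_via_nearby_point:
  fixes x\<^sub>j x\<^sub>k y\<^sub>j y\<^sub>k a b :: "'a::real_normed_vector"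
  assumes "norm ((x\<^sub>j - a) - (y\<^sub>j - b)) < 3 * d" "norm ((x\<^sub>k - a) - (y\<^sub>k - b)) < 3 * d"
    "norm (y\<^sub>j - y\<^sub>k) < d"
  shows "norm (x\<^sub>j - x\<^sub>k) < 7 * d"
proof -
  have "x\<^sub>j - x\<^sub>k = (((x\<^sub>j - a) - (y\<^sub>j - b)) - ((x\<^sub>k - a) - (y\<^sub>k - b))) + (y\<^sub>j - y\<^sub>k)"
    by simp
  then have "norm (x\<^sub>j - x\<^sub>k)
      \<le> norm (((x\<^sub>j - a) - (y\<^sub>j - b)) - ((x\<^sub>k - a) - (y\<^sub>k - b))) + norm (y\<^sub>j - y\<^sub>k)"
    by (metis norm_triangle_ineq)
  also have "\<dots> < 7 * d"
    using norm_triangle_ineq4[of "(x\<^sub>j - a) - (y\<^sub>j - b)" "(x\<^sub>k - a) - (y\<^sub>k - b)"] assms by simp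
  finally show ?thesis .
qed

theorem theorem4p18:
  fixes T :: "real set"
    and f :: "nat \<Rightarrow> real \<Rightarrow> 'a::real_normed_vector"
  assumes "T \<noteq> {}"
    and "pointwise_relatively_compact f T"
    and "\<And>\<epsilon>::real. 0 < \<epsilon> \<Longrightarrow>
           double_limsup (\<lambda>j k. eps_variation \<epsilon> (\<lambda>t. f j t - f k t) T) < \<infinity>"
  shows "\<exists>(r::nat \<Rightarrow> nat) (g::real \<Rightarrow> 'a).
           strict_mono r \<and> (\<forall>t\<in>T. (\<lambda>n. f (r n) t) \<longlonglongrightarrow> g t)"
proof -
  define \<epsilon> where "\<epsilon> p = inverse (real (Suc p))" for p
  have \<epsilon>_pos: "0 < \<epsilon> p" for p
    by (simp add: \<epsilon>_def)
  have "\<exists>N C (g::nat \<Rightarrow> real \<Rightarrow> 'a). 0 \<le> C \<and> (\<forall>j. jordan_variation (g j) T \<le> ennreal C) \<and>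
      (\<forall>j\<ge>N. \<forall>t\<in>T. norm (f j t - f N t - g j t) \<le> \<epsilon> p)" for p
    by (rule bounded_variation_approximants[OF assms(3)[OF \<epsilon>_pos] \<epsilon>_pos, of p]) metis
  then obtain N C and g :: "nat \<Rightarrow> nat \<Rightarrow> real \<Rightarrow> 'a" where C: "\<And>p. 0 \<le> C p"
    and var: "\<And>p j. jordan_variation (g p j) T \<le> ennreal (C p)"
    and close: "\<And>p j t. N p \<le> j \<Longrightarrow> t \<in> T \<Longrightarrow> norm (f j t - f (N p) t - g p j t) \<le> \<epsilon> p"
    by metis
  have fin: "jordan_variation (g p j) T < \<infinity>" for p j
    using var[of p j] by (auto intro: le_less_trans)
  define F where "F p j = variation_function (g p j) T" for p j
  obtain r D where r: "strict_mono r" and D: "countable D"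
    and small: "\<And>p x e. x \<notin> D \<Longrightarrow> 0 < e \<Longrightarrow>
      \<exists>a b. a < x \<and> x < b \<and> (\<forall>\<^sub>F n in sequentially. F p (r n) b - F p (r n) a < e)"
  proof (rule monotone_family_small_increments[of F C])
    show "mono (F p j)" for p j
      unfolding F_def by (rule mono_variation_function[OF fin])
    show "0 \<le> F p j x" for p j x
      by (simp add: F_def variation_function_def)
    show "F p j x \<le> C p" for p j x
      unfolding F_def by (rule variation_function_le[OF fin var C])
  qed blast
  obtain S\<^sub>0 where S\<^sub>0: "countable S\<^sub>0" "S\<^sub>0 \<subseteq> T" "T \<subseteq> closure S\<^sub>0"
    by (rule separable)
  define S where "S = S\<^sub>0 \<union> (D \<inter> T)"
  have S: "countable S" "S \<subseteq> T" "S \<noteq> {}"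
    using S\<^sub>0 D assms(1) by (auto simp: S_def)
  obtain r' where r': "strict_mono r'"
    and conv_enum: "\<And>i. convergent (\<lambda>n. f (r (r' n)) (from_nat_into S i))"
  proof (rule countable_family_convergent_subsequence
      [where u = "\<lambda>n i. f (r n) (from_nat_into S i)"
         and K = "\<lambda>i. closure (range (\<lambda>j. f j (from_nat_into S i)))"])
    show "compact (closure (range (\<lambda>j. f j (from_nat_into S i))))" for i
      using assms(2) from_nat_into[OF S(3), of i] S(2)
      by (auto simp: pointwise_relatively_compact_def)
    show "f (r n) (from_nat_into S i) \<in> closure (range (\<lambda>j. f j (from_nat_into S i)))" for n i
      by (rule subsetD[OF closure_subset]) simp
  qed blast
  define \<rho> where "\<rho> n = r (r' n)" for n
  have \<rho>: "strict_mono \<rho>"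
    using strict_mono_o[OF r r'] by (simp add: \<rho>_def[abs_def] o_def)
  have Cauchy_S: "Cauchy (\<lambda>n. f (\<rho> n) s)" if "s \<in> S" for s
  proof -
    have "convergent (\<lambda>n. f (\<rho> n) s)"
      using conv_enum[of "to_nat_on S s"] S(1) that by (simp add: \<rho>_def)
    then show ?thesis
      by (rule convergent_Cauchy)
  qed
  have Cauchy_T: "Cauchy (\<lambda>n. f (\<rho> n) t)" if t: "t \<in> T" for t
  proof (cases "t \<in> D")
    case True
    then show ?thesis
      using Cauchy_S t by (simp add: S_def)
  next
    case False
    show ?thesis
    proof (rule metric_CauchyI)
      fix e :: real assume "0 < e"
      \<comment> \<open>Two oscillations of \<open>3 * d\<close> (twice the approximation error and one increment of the
        variation function) and one Cauchy difference at \<open>s\<close> add up to \<open>7 * d\<close>.\<close>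
      define d where "d = e / 7"
      have "0 < d"
        using \<open>0 < e\<close> by (simp add: d_def)
      then obtain p where p: "\<epsilon> p < d"
        unfolding \<epsilon>_def by (metis reals_Archimedean)
      obtain a b where ab: "a < t" "t < b"
        and F_small: "\<forall>\<^sub>F n in sequentially. F p (r n) b - F p (r n) a < d"
        using small[OF False \<open>0 < d\<close>, of p] by blast
      have "\<forall>\<^sub>F n in sequentially. F p (\<rho> n) b - F p (\<rho> n) a < d"
        unfolding \<rho>_def by (rule eventually_compose_filterlim[OF F_small filterlim_subseq[OF r']])
      moreover have "\<forall>\<^sub>F n in sequentially. N p \<le> \<rho> n"
        using filterlim_subseq[OF \<rho>] by (simp add: filterlim_at_top)
      ultimately have "\<forall>\<^sub>F n in sequentially. F p (\<rho> n) b - F p (\<rho> n) a < d \<and> N p \<le> \<rho> n"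
        by (rule eventually_conj)
      then obtain n\<^sub>1 where n\<^sub>1: "\<And>n. n\<^sub>1 \<le> n \<Longrightarrow> F p (\<rho> n) b - F p (\<rho> n) a < d \<and> N p \<le> \<rho> n"
        by (auto simp: eventually_sequentially)
      have "{a<..<b} \<inter> S\<^sub>0 \<noteq> {}"
        using S\<^sub>0(3) t ab open_Int_closure_eq_empty[of "{a<..<b}" S\<^sub>0] by auto
      then obtain s where s: "s \<in> S\<^sub>0" "a < s" "s < b"
        by auto
      have osc: "norm ((f (\<rho> n) t - f (N p) t) - (f (\<rho> n) s - f (N p) s)) < 3 * d"
        if "n\<^sub>1 \<le> n" for n
      proof -
        have "s \<in> T"
          using s S\<^sub>0 by auto
        let ?h = "\<lambda>x. f (\<rho> n) x - f (N p) x" and ?g = "g p (\<rho> n)"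
        have "norm (?h t - ?h s) = norm ((?h t - ?g t) - (?h s - ?g s) + (?g t - ?g s))"
          by simp
        also have "\<dots> \<le> norm (?h t - ?g t) + norm (?h s - ?g s) + norm (?g t - ?g s)"
          by (meson add_right_mono norm_triangle_ineq norm_triangle_ineq4 order_trans)
        also have "norm (?g t - ?g s) \<le> F p (\<rho> n) b - F p (\<rho> n) a"
          unfolding F_def using fin \<open>s \<in> T\<close> t s ab
          by (intro norm_diff_le_variation_increment) auto
        finally show ?thesis
          using n\<^sub>1[OF that] close[of p "\<rho> n" t] close[of p "\<rho> n" s] t \<open>s \<in> T\<close> p by simp
      qed
      obtain n\<^sub>2 where n\<^sub>2: "\<And>m n. n\<^sub>2 \<le> m \<Longrightarrow> n\<^sub>2 \<le> n \<Longrightarrow> norm (f (\<rho> m) s - f (\<rho> n) s) < d"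
        using metric_CauchyD[OF Cauchy_S \<open>0 < d\<close>, of s] s(1) by (auto simp: S_def dist_norm)
      have "norm (f (\<rho> m) t - f (\<rho> n) t) < 7 * d" if "max n\<^sub>1 n\<^sub>2 \<le> m" "max n\<^sub>1 n\<^sub>2 \<le> n" for m n
        by (rule norm_diff_via_nearby_point[OF osc osc n\<^sub>2]) (use that in auto)
      then show "\<exists>M. \<forall>m\<ge>M. \<forall>n\<ge>M. dist (f (\<rho> m) t) (f (\<rho> n) t) < e"
        unfolding dist_norm d_def by fastforce
    qed
  qed
  have "\<exists>l. (\<lambda>n. f (\<rho> n) t) \<longlonglongrightarrow> l" if t: "t \<in> T" for t
  proof -
    have "complete (closure (range (\<lambda>j. f j t)))"
      using assms(2) t by (auto simp: pointwise_relatively_compact_def intro: compact_imp_complete)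
    moreover have "f (\<rho> n) t \<in> closure (range (\<lambda>j. f j t))" for n
      by (rule subsetD[OF closure_subset]) simp
    ultimately show ?thesis
      using Cauchy_T[OF t] by (meson completeE)
  qed
  then show ?thesis
    using \<rho> by metis
qed

end
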